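(* Let $k$ be an algebraically closed field of characteristic zero and let $L$ be a finite dimensional metabelian Lie algebra over $k$ with $\dim[L,L]=2$ and $i(L)=2$ or $3$. Then $L$ admits a CP.
   Context: Here "metabelian" means $[L,L]\subset Z(L)$, where $Z(L)$ is the center of $L$. For $\xi\in L^*$ put $L(\xi)=\{x\in L : \xi([x,y])=0 \text{ for all } y\in L\}$; the index is $i(L)=\min_{\xi\in L^*}\dim L(\xi)$; the magic number is $c(L)=(\dim L+i(L))/2$ (an integer). A CP (commutative polarization) of $L$ is a commutative subalgebra $P$ of $L$ with $\dim P=c(L)$. *)

theory Defs
  imports "HOL-Computational_Algebra.Polynomial"
begin

text \<open>
  The underlying vector space of a Lie algebra is the whole type \<^typ>\<open>'b\<close>, following the
  conventions of the locale \<^locale>\<open>vector_space\<close>.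
\<close>

locale lie_algebra = vector_space scale
  for scale :: "'a::field \<Rightarrow> 'b::ab_group_add \<Rightarrow> 'b" (infixr "*s" 75) +
  fixes bracket :: "'b \<Rightarrow> 'b \<Rightarrow> 'b" ("\<lbrakk>_,/ _\<rbrakk>")
  assumes bracket_add_left: "\<lbrakk>x + y, z\<rbrakk> = \<lbrakk>x, z\<rbrakk> + \<lbrakk>y, z\<rbrakk>"
    and bracket_add_right: "\<lbrakk>x, y + z\<rbrakk> = \<lbrakk>x, y\<rbrakk> + \<lbrakk>x, z\<rbrakk>"
    and bracket_scale_left: "\<lbrakk>c *s x, y\<rbrakk> = c *s \<lbrakk>x, y\<rbrakk>"
    and bracket_scale_right: "\<lbrakk>x, c *s y\<rbrakk> = c *s \<lbrakk>x, y\<rbrakk>"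
    and bracket_self: "\<lbrakk>x, x\<rbrakk> = 0"
    and jacobi: "\<lbrakk>x, \<lbrakk>y, z\<rbrakk>\<rbrakk> + \<lbrakk>y, \<lbrakk>z, x\<rbrakk>\<rbrakk> + \<lbrakk>z, \<lbrakk>x, y\<rbrakk>\<rbrakk> = 0"
begin

definition derived_algebra :: "'b set"
  where "derived_algebra = span {\<lbrakk>x, y\<rbrakk> | x y. True}"

definition center :: "'b set"
  where "center = {z. \<forall>x. \<lbrakk>z, x\<rbrakk> = 0}"

text \<open>
  This is the two-step nilpotent sense of the word; elsewhere ``metabelian'' often only
  means that the derived algebra is commutative.
\<close>

definition metabelian :: bool
  where "metabelian \<longleftrightarrow> derived_algebra \<subseteq> center"

definition dual_space :: "('b \<Rightarrow> 'a) set"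
  where "dual_space = {\<xi>. Vector_Spaces.linear scale (*) \<xi>}"

text \<open>The subspace $L(\xi)$, i.e. the radical of the form $(x,y) \mapsto \xi([x,y])$.\<close>

definition form_radical :: "('b \<Rightarrow> 'a) \<Rightarrow> 'b set"
  where "form_radical \<xi> = {x. \<forall>y. \<xi> \<lbrakk>x, y\<rbrakk> = 0}"

definition index :: nat
  where "index = (INF \<xi>\<in>dual_space. dim (form_radical \<xi>))"

text \<open>
  The magic number is always an integer, but it is kept rational here so that the division
  by two is exact by definition.
\<close>

definition magic_number :: rat
  where "magic_number = (of_nat (dim (UNIV :: 'b set)) + of_nat index) / 2"

definition subalgebra :: "'b set \<Rightarrow> bool"
  where "subalgebra P \<longleftrightarrow> subspace P \<and> (\<forall>x\<in>P. \<forall>y\<in>P. \<lbrakk>x, y\<rbrakk> \<in> P)"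

definition commutative :: "'b set \<Rightarrow> bool"
  where "commutative P \<longleftrightarrow> (\<forall>x\<in>P. \<forall>y\<in>P. \<lbrakk>x, y\<rbrakk> = 0)"

definition commutative_polarization :: "'b set \<Rightarrow> bool"
  where "commutative_polarization P \<longleftrightarrow>
    subalgebra P \<and> commutative P \<and> of_nat (dim P) = magic_number"

lemma zero_in_dual_space: "(\<lambda>_. 0) \<in> dual_space"
proof -
  interpret vector_space_pair scale "(*) :: 'a \<Rightarrow> 'a \<Rightarrow> 'a"
    by unfold_locales (simp_all add: algebra_simps)
  show ?thesis
    unfolding dual_space_def using linear_zero by simp
qed

text \<open>The infimum in the definition of the index is an attained minimum.\<close>

lemma index_attained: "\<exists>\<xi>\<in>dual_space. dim (form_radical \<xi>) = index"
proof -
  have "index \<in> (\<lambda>\<xi>. dim (form_radical \<xi>)) ` dual_space"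
    unfolding index_def using zero_in_dual_space by (intro Inf_nat_def1) auto
  then show ?thesis by auto
qed

lemma index_le: "\<xi> \<in> dual_space \<Longrightarrow> index \<le> dim (form_radical \<xi>)"
  unfolding index_def by (rule cINF_lower) auto

end

locale finite_dimensional_lie_algebra = lie_algebra +
  assumes finite_dimensional: "\<exists>B. finite B \<and> span B = UNIV"

end

theory Submission
  imports Defs
begin

text \<open>
  Write \<open>D = [L,L]\<close> and choose linear functionals \<open>\<xi>\<close>, attaining the index, and \<open>\<eta>\<close>, such that
  \<open>\<xi>\<close> and \<open>\<eta>\<close> have no common zero in \<open>D\<close> but \<open>0\<close>. With \<open>A(x,y) = \<xi>[x,y]\<close> and
  \<open>B(x,y) = \<eta>[x,y]\<close>, a subspace is commutative iff it is isotropic for both alternating forms, and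
  it then is a CP iff its dimension is half of \<open>dim L + dim Rad A\<close>, that is, iff it is a maximal
  isotropic subspace for \<open>A\<close>. So a common Lagrangian subspace of \<open>A\<close> and \<open>B\<close> is wanted
  (theorem \<open>common_lagrangian\<close>).

  Think of \<open>T = A\<^sup>-\<^sup>1 B\<close>, the partially defined operator with \<open>A(Tx, y) = B(x, y)\<close>. The proof looks at
  \<open>T\<close>-invariant common isotropic subspaces \<open>P\<close> that contain \<open>Rad A\<close>; invariance is expressed by
  \<open>P\<^sup>\<bottom>\<^sup>A \<subseteq> P\<^sup>\<bottom>\<^sup>B\<close>.

  Such subspaces exist: since the index is at most 3 and \<open>D\<close> is central of dimension 2, \<open>Rad A\<close> is
  spanned by \<open>D\<close> and at most one further vector \<open>v\<close>. The only obstruction to applying \<open>T\<close> to \<open>x\<close> is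
  then \<open>B(x, v)\<close>, and it vanishes along the orbit \<open>v, Tv, T\<^sup>2v, \<dots>\<close>, because \<open>A(Tx, y) = B(x, y)\<close> and
  the alternation of both forms make every such orbit isotropic (lemma \<open>chain_isotropic\<close>). Hence
  \<open>D\<close> and the orbit of \<open>v\<close> span a subspace of the required kind.

  Such subspaces can be enlarged: if \<open>P \<noteq> P\<^sup>\<bottom>\<^sup>A\<close>, then \<open>T\<close> is defined on \<open>P\<^sup>\<bottom>\<^sup>A\<close> and induces an operator on
  the nonzero space \<open>P\<^sup>\<bottom>\<^sup>A / P\<close>, which has an eigenvector because the field is algebraically closed.
  Adjoining a preimage of it gives a larger \<open>P\<close> (lemma \<open>invariant_isotropic_extend\<close>). One that is of
  maximal dimension therefore equals its own \<open>A\<close>-orthogonal, so it is Lagrangian.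
\<close>

section \<open>Alternating forms on finite-dimensional spaces\<close>

context finite_dimensional_vector_space
begin

lemma subspace_extend_by_finite:
  assumes "subspace U" "U \<subseteq> W"
  obtains E where "finite E" "card E + dim U = dim W" "W \<subseteq> span (U \<union> E)"
proof -
  obtain R where R: "R \<subseteq> U" "independent R" "U \<subseteq> span R" "card R = dim U"
    using basis_exists by blast
  obtain C where C: "R \<subseteq> C" "C \<subseteq> W" "independent C" "W \<subseteq> span C"
    using maximal_independent_subset_extend[of R W] R assms by blast
  have "finite C" using C finiteI_independent by blast
  have "dim W = card C" using C by (metis basis_card_eq_dim)
  moreover have "card (C - R) + card R = card C"
    using \<open>finite C\<close> C(1) by (simp add: card_Diff_subset card_mono finite_subset)
  moreover have "W \<subseteq> span (U \<union> (C - R))"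
  proof -
    have "C \<subseteq> U \<union> (C - R)" using R(1) by blast
    then show ?thesis using C(4) span_mono by blast
  qed
  ultimately show ?thesis using that[of "C - R"] \<open>finite C\<close> R(4) by simp
qed

lemma subspace_codim_le_1:
  assumes "subspace U" "subspace W" "U \<subseteq> W" "dim W \<le> dim U + 1"
  obtains v where "W = span (insert v U)"
proof (cases "U = W")
  case True
  have "W = span (insert 0 U)"
    unfolding span_insert_0 True using assms(2) by (metis span_eq_iff)
  then show ?thesis by (rule that)
next
  case False
  then obtain v where v: "v \<in> W" "v \<notin> U" using assms(3) by blast
  have "span (insert v U) \<subseteq> W"
    using v(1) assms(2,3) by (intro span_minimal) auto
  moreover have "dim (span (insert v U)) = dim U + 1"
    using v(2) assms(1) span_eq_iff[of U] by (simp add: dim_insert del: span_eq_iff)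
  ultimately have "span (insert v U) = W"
    using assms by (intro subspace_dim_equal) auto
  then show ?thesis using that by blast
qed

lemma dim_Int_kernel:
  assumes "subspace W"
    and add: "\<And>x y. g (x + y) = g x + g y" and scale: "\<And>c x. g (c *s x) = c * g x"
  shows "dim W \<le> dim (W \<inter> {x. g x = 0}) + 1"
proof (cases "W \<subseteq> {x. g x = 0}")
  case True
  then have "W \<inter> {x. g x = 0} = W" by blast
  then show ?thesis by simp
next
  case False
  then obtain u where u: "u \<in> W" "g u \<noteq> 0" by blast
  have "W \<subseteq> span (insert u (W \<inter> {x. g x = 0}))"
  proof
    fix x assume x: "x \<in> W"
    define c where "c = - (g x / g u)"
    have "x + c *s u \<in> W" using x u(1) assms(1) by (simp add: subspace_add subspace_scale)
    moreover have "g (x + c *s u) = g x + c * g u" by (simp only: add scale)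
    then have "g (x + c *s u) = 0" using u(2) by (simp add: c_def)
    ultimately have "x + c *s u \<in> span (insert u (W \<inter> {x. g x = 0}))"
      by (intro span_base) blast
    moreover have "c *s u \<in> span (insert u (W \<inter> {x. g x = 0}))"
      by (intro span_scale span_base) blast
    ultimately have "(x + c *s u) - c *s u \<in> span (insert u (W \<inter> {x. g x = 0}))"
      by (rule span_diff)
    then show "x \<in> span (insert u (W \<inter> {x. g x = 0}))" by simp
  qed
  then have "dim W \<le> dim (span (insert u (W \<inter> {x. g x = 0})))" by (rule dim_subset)
  also have "\<dots> \<le> dim (W \<inter> {x. g x = 0}) + 1" by (simp add: dim_insert)
  finally show ?thesis .
qed

end

locale alternating_form = finite_dimensional_vector_space scale Basis
  for scale :: "'a::field \<Rightarrow> 'b::ab_group_add \<Rightarrow> 'b" (infixr "*s" 75)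
    and Basis :: "'b set" +
  fixes form :: "'b \<Rightarrow> 'b \<Rightarrow> 'a"
  assumes form_add_left: "form (x + y) z = form x z + form y z"
    and form_add_right: "form x (y + z) = form x y + form x z"
    and form_scale_left: "form (c *s x) y = c * form x y"
    and form_scale_right: "form x (c *s y) = c * form x y"
    and form_self [simp]: "form x x = 0"
begin

definition radical :: "'b set"
  where "radical = {x. \<forall>y. form x y = 0}"

definition perp :: "'b set \<Rightarrow> 'b set"
  where "perp S = {y. \<forall>x\<in>S. form x y = 0}"

lemma form_skew: "form x y = - form y x"
proof -
  have "form (x + y) (x + y) = 0" by (rule form_self)
  then have "form x y + form y x = 0"
    unfolding form_add_left form_add_right by (simp add: add.commute)
  then show ?thesis by (simp add: eq_neg_iff_add_eq_0)
qed

lemma form_zero_left [simp]: "form 0 y = 0"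
  using form_scale_left[of 0 0 y] by simp

lemma form_zero_right [simp]: "form x 0 = 0"
  using form_scale_right[of x 0 0] by simp

lemma subspace_perp: "subspace (perp S)"
  by (auto simp: subspace_def perp_def form_add_right form_scale_right)

lemma radical_iff_right: "x \<in> radical \<longleftrightarrow> (\<forall>y. form y x = 0)"
proof -
  have "form x y = 0 \<longleftrightarrow> form y x = 0" for y by (subst form_skew) simp
  then show ?thesis by (simp add: radical_def)
qed

lemma radical_eq_perp_UNIV: "radical = perp UNIV"
  by (auto simp: radical_iff_right perp_def)

lemma subspace_radical: "subspace radical"
  unfolding radical_eq_perp_UNIV by (rule subspace_perp)

lemma perp_antimono: "S \<subseteq> T \<Longrightarrow> perp T \<subseteq> perp S"
  by (auto simp: perp_def)

lemma perp_span: "perp (span S) = perp S"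
proof
  show "perp (span S) \<subseteq> perp S" by (rule perp_antimono) (rule span_superset)
  show "perp S \<subseteq> perp (span S)"
  proof
    fix y assume y: "y \<in> perp S"
    have "subspace {x. form x y = 0}"
      by (auto simp: subspace_def form_add_left form_scale_left)
    moreover have "S \<subseteq> {x. form x y = 0}" using y by (auto simp: perp_def)
    ultimately have "span S \<subseteq> {x. form x y = 0}" by (rule span_minimal[rotated])
    then show "y \<in> perp (span S)" by (auto simp: perp_def)
  qed
qed

lemma perp_Un: "perp (S \<union> T) = perp S \<inter> perp T"
  by (auto simp: perp_def)

lemma perp_radical: "perp radical = UNIV"
  by (auto simp: perp_def radical_def)

lemma dim_Int_perp:
  assumes "finite E" "subspace W"
  shows "dim W \<le> dim (W \<inter> perp E) + card E"
  using assms
proof (induction E)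
  case empty
  then show ?case by (simp add: perp_def)
next
  case (insert e E)
  have "subspace (W \<inter> perp E)"
    using insert.prems subspace_perp by (rule subspace_inter)
  then have "dim (W \<inter> perp E) \<le> dim (W \<inter> perp E \<inter> {x. form e x = 0}) + 1"
    by (rule dim_Int_kernel) (simp_all add: form_add_right form_scale_right)
  moreover have "W \<inter> perp E \<inter> {x. form e x = 0} = W \<inter> perp (insert e E)"
    by (auto simp: perp_def)
  ultimately show ?case using insert by simp
qed

text \<open>
  Both inequalities count conditions: \<open>P\<^sup>\<bottom>\<close> is cut out by \<open>dim P - dim Rad\<close> equations, because the
  radical imposes none, and \<open>Rad\<close> is cut out of an isotropic \<open>P\<close> by \<open>dim V - dim P\<close> equations,
  because \<open>P\<close> itself imposes none.
\<close>

lemma dim_lagrangian: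
  assumes "perp P = P"
  shows "2 * dim P = dim UNIV + dim radical"
proof (rule antisym)
  have P: "subspace P" using subspace_perp[of P] assms by simp
  have "radical \<subseteq> P"
    using perp_antimono[of P UNIV] assms by (simp add: radical_eq_perp_UNIV)
  then obtain E where E: "finite E" "card E + dim radical = dim P" "P \<subseteq> span (radical \<union> E)"
    using subspace_extend_by_finite[OF subspace_radical] by metis
  have "perp E \<subseteq> P"
    using perp_antimono[OF E(3)] assms by (simp add: perp_span perp_Un perp_radical)
  then have "dim (perp E) \<le> dim P" by (rule dim_subset)
  moreover have "dim UNIV \<le> dim (perp E) + card E"
    using dim_Int_perp[OF E(1) subspace_UNIV] by simp
  ultimately show "dim UNIV + dim radical \<le> 2 * dim P" using E(2) by linarith

  obtain F where F: "finite F" "card F + dim P = dim UNIV" "UNIV \<subseteq> span (P \<union> F)"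
    using subspace_extend_by_finite[OF P subset_UNIV] by metis
  have "perp P \<inter> perp F \<subseteq> radical"
    using perp_antimono[OF F(3)] by (simp add: perp_span perp_Un radical_eq_perp_UNIV)
  then have "dim (P \<inter> perp F) \<le> dim radical"
    using assms by (intro dim_subset) simp
  moreover have "dim P \<le> dim (P \<inter> perp F) + card F"
    using F(1) P by (rule dim_Int_perp)
  ultimately show "2 * dim P \<le> dim UNIV + dim radical" using F(2) by linarith
qed

text \<open>
  Induction on \<open>E\<close>: a vector of \<open>E\<^sup>\<bottom>\<close> that is not orthogonal to the new element \<open>e\<close> tells which
  multiple of \<open>form e\<close> has to be subtracted from \<open>f\<close>.
\<close>

lemma represent_on_perp:
  assumes "finite E"
    and "\<And>x y. f (x + y) = f x + f y" and "\<And>c x. f (c *s x) = c * f x"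
    and "\<And>y. y \<in> perp E \<Longrightarrow> f y = 0"
  shows "\<exists>x. \<forall>y. form x y = f y"
  using assms
proof (induction E arbitrary: f)
  case empty
  have "f y = 0" for y by (rule empty.prems(3)) (simp add: perp_def)
  then have "\<forall>y. form 0 y = f y" by simp
  then show ?case by blast
next
  case (insert e E)
  show ?case
  proof (cases "\<forall>y\<in>perp E. form e y = 0")
    case True
    then have "perp E \<subseteq> perp (insert e E)" by (auto simp: perp_def)
    then have "f y = 0" if "y \<in> perp E" for y
      using insert.prems(3) that by blast
    with insert.prems(1,2) show ?thesis by (rule insert.IH)
  next
    case False
    then obtain u where u: "u \<in> perp E" "form e u \<noteq> 0" by blast
    define c where "c = f u / form e u"
    have "\<exists>x. \<forall>y. form x y = f y - c * form e y"
    proof (rule insert.IH)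
      fix y assume y: "y \<in> perp E"
      define w where "w = y + (- (form e y / form e u)) *s u"
      have "w \<in> perp E"
        unfolding w_def using y u(1) subspace_perp[of E]
        by (intro subspace_add subspace_scale)
      moreover have "form e w = 0"
        unfolding w_def form_add_right form_scale_right using u(2) by simp
      ultimately have "f w = 0" by (intro insert.prems(3)) (simp add: perp_def)
      moreover have "f w = f y - form e y / form e u * f u"
        unfolding w_def insert.prems(1,2) by simp
      ultimately show "f y - c * form e y = 0" by (simp add: c_def)
    qed (simp_all add: insert.prems(1,2) form_add_right form_scale_right algebra_simps)
    then obtain x where "\<forall>y. form x y = f y - c * form e y" by blast
    then have "\<forall>y. form (x + c *s e) y = f y"
      by (simp add: form_add_left form_scale_left)
    then show ?thesis by blast
  qed
qed

lemma represent_functional: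
  assumes "\<And>x y. f (x + y) = f x + f y" and "\<And>c x. f (c *s x) = c * f x"
    and "\<And>y. y \<in> radical \<Longrightarrow> f y = 0"
  shows "\<exists>x. \<forall>y. form x y = f y"
proof (rule represent_on_perp[OF finite_Basis assms(1,2)])
  fix y assume "y \<in> perp Basis"
  then have "y \<in> perp (span Basis)" by (simp only: perp_span)
  then show "f y = 0" using assms(3) by (simp add: span_Basis radical_eq_perp_UNIV)
qed

end

section \<open>Polynomials evaluated along a sequence of vectors\<close>

context finite_dimensional_vector_space
begin

text \<open>
  For an orbit \<open>x n = T\<^sup>n s\<close> this is \<open>p(T) s\<close>. Only the sequence enters, so it also makes sense for an
  orbit under an operator that is linear just modulo a subspace.
\<close>

definition poly_seq :: "(nat \<Rightarrow> 'b) \<Rightarrow> 'a poly \<Rightarrow> 'b"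
  where "poly_seq x p = (\<Sum>i\<le>degree p. coeff p i *s x i)"

lemma poly_seq_upto:
  assumes "degree p \<le> N"
  shows "poly_seq x p = (\<Sum>i\<le>N. coeff p i *s x i)"
  unfolding poly_seq_def
  by (rule sum.mono_neutral_left) (use assms in \<open>auto simp: coeff_eq_0\<close>)

lemma poly_seq_add: "poly_seq x (p + q) = poly_seq x p + poly_seq x q"
proof -
  define N where "N = max (degree p) (degree q)"
  have "degree (p + q) \<le> N" "degree p \<le> N" "degree q \<le> N"
    using degree_add_le_max[of p q] by (auto simp: N_def)
  then show ?thesis
    by (simp add: poly_seq_upto[where N = N] scale_left_distrib sum.distrib)
qed

lemma poly_seq_smult: "poly_seq x (smult c p) = c *s poly_seq x p"
proof -
  have "degree (smult c p) \<le> degree p" by (rule degree_smult_le)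
  then show ?thesis
    by (simp add: poly_seq_upto[where N = "degree p"] scale_sum_right)
qed

lemma poly_seq_pCons_0: "poly_seq x (pCons 0 p) = poly_seq (\<lambda>n. x (Suc n)) p"
proof -
  have "poly_seq x (pCons 0 p) = (\<Sum>i\<le>Suc (degree p). coeff (pCons 0 p) i *s x i)"
    by (rule poly_seq_upto) (rule degree_pCons_le)
  also have "\<dots> = (\<Sum>i\<le>degree p. coeff p i *s x (Suc i))"
    by (subst sum.atMost_Suc_shift) simp
  finally show ?thesis by (simp add: poly_seq_def)
qed

lemma poly_seq_in_subspace:
  assumes "subspace W" "\<And>n. x n \<in> W"
  shows "poly_seq x p \<in> W"
  unfolding poly_seq_def using assms by (intro subspace_sum subspace_scale) auto

lemma poly_seq_monom: "poly_seq x (monom c n) = c *s x n"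
proof -
  have "poly_seq x (monom c n) = (\<Sum>i\<le>n. coeff (monom c n) i *s x i)"
    by (rule poly_seq_upto) (rule degree_monom_le)
  also have "\<dots> = (\<Sum>i\<in>{n}. coeff (monom c n) i *s x i)"
    by (rule sum.mono_neutral_right) auto
  finally show ?thesis by simp
qed

lemma poly_seq_uminus: "poly_seq x (- p) = - poly_seq x p"
  using poly_seq_smult[of x "-1" p] by simp

lemma poly_seq_0 [simp]: "poly_seq x 0 = 0"
  by (simp add: poly_seq_def)

lemma poly_seq_sum: "poly_seq x (\<Sum>i\<in>I. p i) = (\<Sum>i\<in>I. poly_seq x (p i))"
  by (induction I rule: infinite_finite_induct) (simp_all add: poly_seq_add)

lemma annihilating_poly_exists:
  obtains p where "p \<noteq> 0" "poly_seq x p = 0"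
proof (cases "inj x")
  case False
  then obtain i j where ij: "x i = x j" "i \<noteq> j" by (auto simp: inj_on_def)
  have "coeff (monom 1 i + - monom 1 j) i = (1::'a)"
    using ij(2) by simp
  then have "monom 1 i + - monom 1 j \<noteq> (0 :: 'a poly)" by (metis coeff_0 zero_neq_one)
  moreover have "poly_seq x (monom 1 i + - monom 1 j) = 0"
    using ij(1) by (simp only: poly_seq_add poly_seq_uminus poly_seq_monom) simp
  ultimately show ?thesis using that by blast
next
  case True
  then have inj: "inj_on x I" for I by (rule inj_on_subset) simp
  define S where "S = x ` {..dimension}"
  have "card S = Suc dimension" unfolding S_def using inj by (simp add: card_image)
  then have "dependent S"
    using independent_card_le_dim[of S UNIV] dim_subset_UNIV[of UNIV] by auto
  moreover have "finite S" unfolding S_def by simp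
  ultimately obtain u v where u: "v \<in> S" "u v \<noteq> 0" "(\<Sum>v\<in>S. u v *s v) = 0"
    using dependent_finite by blast
  from u(1) obtain n where n: "n \<le> dimension" "v = x n" unfolding S_def by blast
  define p where "p = (\<Sum>i\<le>dimension. monom (u (x i)) i)"
  have "poly_seq x p = (\<Sum>i\<le>dimension. u (x i) *s x i)"
    unfolding p_def by (simp add: poly_seq_sum poly_seq_monom)
  also have "\<dots> = (\<Sum>v\<in>S. u v *s v)"
    unfolding S_def using inj by (simp add: sum.reindex)
  finally have "poly_seq x p = 0" using u(3) by simp
  moreover have "coeff p n = u v"
    unfolding p_def n(2) using n(1) by (simp add: coeff_sum)
  then have "p \<noteq> 0" using u(2) by auto
  ultimately show ?thesis using that by blast
qed

end

section \<open>Pairs of alternating forms\<close>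

locale alternating_pair = finite_dimensional_vector_space scale Basis
    + A: alternating_form scale Basis A + B: alternating_form scale Basis B
  for scale :: "'a::field \<Rightarrow> 'b::ab_group_add \<Rightarrow> 'b" (infixr "*s" 75)
    and Basis :: "'b set" and A B :: "'b \<Rightarrow> 'b \<Rightarrow> 'a"
begin

text \<open>
  The last two inclusions make \<open>P\<close> isotropic for both forms. The last one means that
  every functional \<open>B(x, \<cdot>)\<close> with \<open>x \<in> P\<close> is of the form \<open>A(x', \<cdot>)\<close> with \<open>x' \<in> P\<close>, i.e. \<open>P\<close> is invariant
  under \<open>A\<^sup>-\<^sup>1 B\<close>; stated for orthogonals it needs no choice of \<open>x'\<close>.
\<close>

definition invariant_isotropic :: "'b set \<Rightarrow> bool"
  where "invariant_isotropic P \<longleftrightarrow>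
    subspace P \<and> A.radical \<subseteq> P \<and> P \<subseteq> A.perp P \<and> A.perp P \<subseteq> B.perp P"

text \<open>
  Moving a step of the chain from one argument to the other turns \<open>A(v\<^sub>i, v\<^sub>j)\<close> into \<open>\<plusminus> B(v\<^sub>i, v\<^bsub>j-1\<^esub>)\<close>
  and \<open>B(v\<^sub>i, v\<^sub>j)\<close> into \<open>A(v\<^bsub>i+1\<^esub>, v\<^sub>j)\<close>. Either way the distance of the indices shrinks by one, and at
  distance zero the forms vanish since they are alternating.
\<close>

lemma chain_isotropic_aux:
  assumes chain: "\<And>i y. i < N \<Longrightarrow> A (v (Suc i)) y = B (v i) y"
  shows "i + d \<le> N \<Longrightarrow> A (v i) (v (i + d)) = 0 \<and> B (v i) (v (i + d)) = 0"
proof (induction d arbitrary: i)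
  case (Suc d)
  have "A (v i) (v (i + Suc d)) = - A (v (Suc (i + d))) (v i)"
    by (subst A.form_skew) simp
  also have "\<dots> = - B (v (i + d)) (v i)" using chain[of "i + d"] Suc.prems by simp
  also have "\<dots> = B (v i) (v (i + d))" by (subst B.form_skew) simp
  also have "\<dots> = 0" using Suc by simp
  finally have "A (v i) (v (i + Suc d)) = 0" .
  moreover have "B (v i) (v (i + Suc d)) = A (v (Suc i)) (v (Suc i + d))"
    using chain[of i] Suc.prems by simp
  ultimately show ?case using Suc.IH[of "Suc i"] Suc.prems by simp
qed simp

lemma chain_isotropic:
  assumes "\<And>i y. i < N \<Longrightarrow> A (v (Suc i)) y = B (v i) y" and "i \<le> N" "j \<le> N"
  shows "A (v i) (v j) = 0" "B (v i) (v j) = 0"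
proof -
  have less: "A (v i) (v j) = 0 \<and> B (v i) (v j) = 0" if "i \<le> j" "j \<le> N" for i j
    using chain_isotropic_aux[of N v i "j - i"] assms(1) that by simp
  show "A (v i) (v j) = 0" "B (v i) (v j) = 0"
    using less[of i j] less[of j i] assms(2,3)
      A.form_skew[of "v i" "v j"] B.form_skew[of "v i" "v j"]
    by (cases "i \<le> j"; simp)+
qed

text \<open>
  The functional \<open>B(v\<^sub>n, \<cdot>)\<close> vanishes on \<open>N\<close> by assumption and at \<open>v\<^sub>0\<close> because the chain up to \<open>v\<^sub>n\<close> is
  isotropic, so it is represented by \<open>A\<close> and the chain can be continued. A second generator of the
  radical modulo \<open>N\<close> could obstruct this.
\<close>

lemma infinite_chain_exists:
  assumes rad: "A.radical = span (insert v0 N)" and N: "N \<subseteq> B.radical"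
  obtains v where "v 0 = v0" "\<And>i y. A (v (Suc i)) y = B (v i) y"
proof -
  define T where "T x = (SOME x'. \<forall>y. A x' y = B x y)" for x
  define v where "v n = (T ^^ n) v0" for n
  have v_Suc: "v (Suc n) = T (v n)" for n by (simp add: v_def)
  have v_0: "v 0 = v0" by (simp add: v_def)
  have "\<forall>y. A (v (Suc n)) y = B (v n) y" for n
  proof (induction n rule: less_induct)
    case (less n)
    have "B (v n) (v 0) = 0"
      using chain_isotropic(2)[of n v n 0] less by blast
    then have "insert v0 N \<subseteq> B.perp {v n}"
      using N v_0 by (auto simp: B.perp_def B.radical_iff_right)
    then have "A.radical \<subseteq> B.perp {v n}"
      unfolding rad using B.subspace_perp by (rule span_minimal)
    then have "\<exists>x'. \<forall>y. A x' y = B (v n) y"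
      by (intro A.represent_functional)
        (auto simp: B.form_add_right B.form_scale_right B.perp_def)
    then show ?case unfolding v_Suc T_def by (rule someI_ex)
  qed
  then show ?thesis using that v_0 by blast
qed

lemma invariant_isotropic_exists:
  assumes rad: "A.radical = span (insert v0 N)" and N: "N \<subseteq> B.radical"
  shows "\<exists>P. invariant_isotropic P"
proof -
  obtain v where v: "v 0 = v0" "\<And>i y. A (v (Suc i)) y = B (v i) y"
    using infinite_chain_exists[OF assms] by blast
  have NA: "N \<subseteq> A.radical" unfolding rad using span_superset by blast
  define S where "S = N \<union> range v"
  have "insert v0 N \<subseteq> S" using v(1) by (auto simp: S_def)
  then have "A.radical \<subseteq> span S" unfolding rad by (rule span_mono)
  moreover have "A (v i) (v j) = 0" for i j
    using chain_isotropic(1)[of "max i j" v i j] v(2) by simp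
  then have "S \<subseteq> A.perp S"
    using NA by (auto simp: S_def A.perp_def A.radical_iff_right)
      (auto simp: A.radical_def subset_iff)
  then have "span S \<subseteq> A.perp (span S)"
    unfolding A.perp_span using A.subspace_perp by (rule span_minimal)
  moreover have "A.perp S \<subseteq> B.perp S"
  proof
    fix y assume "y \<in> A.perp S"
    then have "B (v i) y = 0" for i by (auto simp: S_def A.perp_def simp flip: v(2))
    then show "y \<in> B.perp S" using N by (auto simp: S_def B.perp_def B.radical_def)
  qed
  then have "A.perp (span S) \<subseteq> B.perp (span S)" by (simp only: A.perp_span B.perp_span)
  ultimately have "invariant_isotropic (span S)"
    by (simp add: invariant_isotropic_def)
  then show ?thesis by blast
qed

end

section \<open>Common Lagrangian subspaces\<close>

locale alternating_pair_alg_closed = alternating_pair scale Basis A B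
  for scale :: "'a::alg_closed_field \<Rightarrow> 'b::ab_group_add \<Rightarrow> 'b" (infixr "*s" 75)
    and Basis :: "'b set" and A B :: "'b \<Rightarrow> 'b \<Rightarrow> 'a"
begin

text \<open>
  This is the eigenvector of the operator induced by \<open>A\<^sup>-\<^sup>1 B\<close> on \<open>P\<^sup>\<bottom>\<^sup>A / P\<close>, found without forming the
  quotient. Start the orbit at \<open>s\<close> outside \<open>P\<close>, take a polynomial \<open>p\<close> of least degree that sends \<open>s\<close> into
  \<open>P\<close>, and split off a linear factor: \<open>p = (X - \<lambda>) q\<close>. The cofactor \<open>q\<close> does not send \<open>s\<close> into \<open>P\<close>, and
  it gives the eigenvector.
\<close>

lemma eigenvector_exists:
  assumes P: "invariant_isotropic P" and s: "s \<in> A.perp P" "s \<notin> P"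
  obtains v l where "v \<in> A.perp P" "v \<notin> P" "\<And>y. y \<in> A.perp P \<Longrightarrow> B v y = l * A v y"
proof -
  define Q where "Q = A.perp P"
  have subP: "subspace P" and radP: "A.radical \<subseteq> P" and QB: "Q \<subseteq> B.perp P"
    using P by (auto simp: invariant_isotropic_def Q_def)
  have subQ: "subspace Q" unfolding Q_def by (rule A.subspace_perp)
  have step: "\<exists>x'. x' \<in> Q \<and> (\<forall>y. A x' y = B x y)" if x: "x \<in> Q" for x
  proof -
    have BxP: "B x y = 0" if "y \<in> P" for y
      using that x QB B.form_skew[of x y] by (auto simp: B.perp_def)
    have "\<exists>x'. \<forall>y. A x' y = B x y"
      using BxP radP by (intro A.represent_functional)
        (auto simp: B.form_add_right B.form_scale_right)
    then obtain x' where x': "\<And>y. A x' y = B x y" by blast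
    have "A y x' = 0" if "y \<in> P" for y
      using A.form_skew[of y x'] x' BxP[OF that] by simp
    then show ?thesis using x' by (auto simp: Q_def A.perp_def)
  qed
  have "\<exists>x. \<forall>n. x n \<in> Q \<and> (n = 0 \<longrightarrow> x n = s) \<and> (\<forall>y. A (x (Suc n)) y = B (x n) y)"
    using dependent_nat_choice[where P = "\<lambda>n x. x \<in> Q \<and> (n = 0 \<longrightarrow> x = s)"
        and Q = "\<lambda>n x x'. \<forall>y. A x' y = B x y"] s(1) step
    by (metis Q_def nat.distinct(1))
  then obtain x where xQ: "\<And>n. x n \<in> Q" and x0: "x 0 = s"
    and xSuc: "\<And>n y. A (x (Suc n)) y = B (x n) y" by blast
  obtain p0 where "p0 \<noteq> 0" "poly_seq x p0 = 0" by (rule annihilating_poly_exists)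
  then have "p0 \<noteq> 0 \<and> poly_seq x p0 \<in> P" using subP by (simp add: subspace_0)
  then obtain p where p: "p \<noteq> 0" "poly_seq x p \<in> P"
    and min: "\<And>q. q \<noteq> 0 \<Longrightarrow> poly_seq x q \<in> P \<Longrightarrow> degree p \<le> degree q"
    using ex_has_least_nat[of "\<lambda>p. p \<noteq> 0 \<and> poly_seq x p \<in> P" p0 degree] by blast
  have "degree p > 0"
  proof (rule ccontr)
    assume "\<not> degree p > 0"
    then obtain c where c: "p = [:c:]" by (metis degree_eq_zeroE not_gr_zero)
    then have "c \<noteq> 0" "c *s s \<in> P" using p x0 by (auto simp: poly_seq_def)
    then have "inverse c *s c *s s \<in> P" using subP by (metis subspace_scale)
    then show False using \<open>c \<noteq> 0\<close> s(2) by simp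
  qed
  then obtain l where "poly p l = 0" using alg_closed_imp_poly_has_root by blast
  then obtain q where q: "p = [:- l, 1:] * q" using poly_eq_0_iff_dvd by (metis dvdE)
  then have "q \<noteq> 0" using p(1) by auto
  then have "degree p = Suc (degree q)" using q by (simp add: degree_mult_eq del: mult_pCons_left)
  then have "poly_seq x q \<notin> P" using min[OF \<open>q \<noteq> 0\<close>] by auto
  moreover have "poly_seq x q \<in> Q" by (rule poly_seq_in_subspace[OF subQ xQ])
  moreover have "B (poly_seq x q) y = l * A (poly_seq x q) y" if y: "y \<in> Q" for y
  proof -
    have A_sum: "A (\<Sum>i\<in>I. c i *s u i) y = (\<Sum>i\<in>I. c i * A (u i) y)"
      and B_sum: "B (\<Sum>i\<in>I. c i *s u i) y = (\<Sum>i\<in>I. c i * B (u i) y)" for I :: "nat set" and c u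
      by (induction I rule: infinite_finite_induct)
        (simp_all add: A.form_add_left A.form_scale_left B.form_add_left B.form_scale_left)
    have shift: "A (poly_seq (\<lambda>n. x (Suc n)) q) y = B (poly_seq x q) y"
      by (simp add: poly_seq_def A_sum B_sum xSuc)
    have "p = smult (- l) q + pCons 0 q" using q by simp
    then have "poly_seq x p = (- l) *s poly_seq x q + poly_seq (\<lambda>n. x (Suc n)) q"
      by (simp only: poly_seq_add poly_seq_smult poly_seq_pCons_0)
    then have "A (poly_seq x p) y = - l * A (poly_seq x q) y + B (poly_seq x q) y"
      by (simp only: A.form_add_left A.form_scale_left shift)
    moreover have "A (poly_seq x p) y = 0" using y p(2) by (auto simp: Q_def A.perp_def)
    ultimately show ?thesis by simp
  qed
  ultimately show ?thesis using that[of "poly_seq x q" l] by (simp add: Q_def)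
qed

lemma invariant_isotropic_extend:
  assumes P: "invariant_isotropic P" and "A.perp P \<noteq> P"
  obtains P' where "invariant_isotropic P'" "dim P < dim P'"
proof -
  have subP: "subspace P" and radP: "A.radical \<subseteq> P" and PA: "P \<subseteq> A.perp P"
    and QB: "A.perp P \<subseteq> B.perp P"
    using P by (auto simp: invariant_isotropic_def)
  obtain s where "s \<in> A.perp P" "s \<notin> P" using assms(2) PA by blast
  then obtain v l where v: "v \<in> A.perp P" "v \<notin> P"
    "\<And>y. y \<in> A.perp P \<Longrightarrow> B v y = l * A v y"
    using eigenvector_exists[OF P] by blast
  define S where "S = insert v P"
  have "A x v = 0" "A v x = 0" if "x \<in> P" for x
    using that v(1) A.form_skew[of v x] by (auto simp: A.perp_def)
  then have "S \<subseteq> A.perp S" using PA by (auto simp: S_def A.perp_def)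
  then have "span S \<subseteq> A.perp (span S)"
    unfolding A.perp_span using A.subspace_perp by (rule span_minimal)
  moreover have "A.perp S \<subseteq> B.perp S"
  proof
    fix y assume y: "y \<in> A.perp S"
    then have "y \<in> A.perp P" "A v y = 0" by (auto simp: S_def A.perp_def)
    then show "y \<in> B.perp S" using QB v(3)[of y] by (auto simp: S_def B.perp_def)
  qed
  then have "A.perp (span S) \<subseteq> B.perp (span S)" by (simp only: A.perp_span B.perp_span)
  moreover have "A.radical \<subseteq> span S"
    using radP span_superset[of S] by (auto simp: S_def)
  ultimately have "invariant_isotropic (span S)" by (simp add: invariant_isotropic_def)
  moreover have "v \<notin> span P" using v(2) subP by (metis span_eq_iff)
  then have "dim P < dim (span S)" unfolding S_def by (simp add: dim_insert)
  ultimately show ?thesis using that by blast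
qed

theorem common_lagrangian:
  assumes "A.radical = span (insert v0 N)" "N \<subseteq> B.radical"
  obtains P where "A.perp P = P" "P \<subseteq> B.perp P"
proof -
  obtain P0 where "invariant_isotropic P0"
    using invariant_isotropic_exists[OF assms] by blast
  moreover have "\<forall>P. invariant_isotropic P \<longrightarrow> dim P < Suc dimension"
    using dim_subset_UNIV by (simp add: less_Suc_eq_le)
  ultimately obtain P where P: "invariant_isotropic P"
    and max: "\<And>P'. invariant_isotropic P' \<Longrightarrow> dim P' \<le> dim P"
    using ex_has_greatest_nat[of invariant_isotropic P0 dim] by blast
  have "A.perp P = P"
    using invariant_isotropic_extend[OF P] max by (metis not_less)
  moreover have "P \<subseteq> B.perp P" using P by (auto simp: invariant_isotropic_def)
  ultimately show ?thesis using that by blast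
qed

end

section \<open>Commutative polarizations\<close>

lemma (in finite_dimensional_vector_space) separating_functional_exists:
  assumes "subspace D" "dim D = 2" and \<xi>: "Vector_Spaces.linear scale (*) \<xi>"
    and "\<exists>d\<in>D. \<xi> d \<noteq> 0"
  obtains \<eta> where "Vector_Spaces.linear scale (*) \<eta>"
    "\<And>x. x \<in> D \<Longrightarrow> \<xi> x = 0 \<Longrightarrow> \<eta> x = 0 \<Longrightarrow> x = 0"
proof -
  interpret \<xi>: Vector_Spaces.linear scale "(*)" \<xi> by (rule \<xi>)
  interpret VK: vector_space_pair scale "(*) :: 'a \<Rightarrow> 'a \<Rightarrow> 'a" by unfold_locales
  obtain d where d: "d \<in> D" "\<xi> d \<noteq> 0" using assms(4) by blast
  have "d \<noteq> 0" using d(2) \<xi>.zero by auto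
  then have "independent {d}" by simp
  then obtain E where E: "{d} \<subseteq> E" "E \<subseteq> D" "independent E" "D \<subseteq> span E"
    using maximal_independent_subset_extend[of "{d}" D] d(1) by blast
  have "card E = 2" using E assms(2) by (metis basis_card_eq_dim)
  then obtain e where e: "E = {d, e}" "e \<noteq> d"
    using E(1) by (auto simp: card_2_iff)
  obtain \<eta> where \<eta>: "Vector_Spaces.linear scale (*) \<eta>" "\<eta> d = 0" "\<eta> e = 1"
    using VK.linear_independent_extend[OF E(3), of "\<lambda>x. if x = e then 1 else 0"] e by auto
  interpret \<eta>: Vector_Spaces.linear scale "(*)" \<eta> by (rule \<eta>)
  have "x = 0" if x: "x \<in> D" "\<xi> x = 0" "\<eta> x = 0" for x
  proof -
    have "x \<in> span {d, e}" using x(1) E(4) e(1) by blast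
    then obtain a b where "x - a *s d = b *s e"
      by (auto simp: span_insert span_singleton)
    then have x_eq: "x = a *s d + b *s e" by (simp add: algebra_simps)
    then have "b = 0" using x(3) \<eta>(2,3) by (simp add: \<eta>.add \<eta>.scale)
    moreover from this have "a = 0" using x_eq x(2) d(2) by (simp add: \<xi>.scale)
    ultimately show ?thesis using x_eq by simp
  qed
  then show ?thesis using that \<eta>(1) by blast
qed

theorem corollary7p2:
  fixes scale :: "'k::{alg_closed_field, field_char_0} \<Rightarrow> 'l::ab_group_add \<Rightarrow> 'l"
    and bracket :: "'l \<Rightarrow> 'l \<Rightarrow> 'l"
  assumes "finite_dimensional_lie_algebra scale bracket"
    and "lie_algebra.metabelian scale bracket"
    and "vector_space.dim scale (lie_algebra.derived_algebra scale bracket) = 2"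
    and "lie_algebra.index scale bracket = 2 \<or> lie_algebra.index scale bracket = 3"
  shows "\<exists>P. lie_algebra.commutative_polarization scale bracket P"
proof -
  interpret L: finite_dimensional_lie_algebra scale bracket by (rule assms(1))
  obtain F where F: "finite F" "L.span F = UNIV" using L.finite_dimensional by blast
  obtain Basis where Basis: "Basis \<subseteq> F" "L.independent Basis" "F \<subseteq> L.span Basis"
    using L.maximal_independent_subset[of F] by blast
  have "L.span Basis = UNIV"
    using Basis(3) F(2) L.span_mono[of F "L.span Basis"] by (simp add: L.span_span top.extremum_unique)
  then interpret V: finite_dimensional_vector_space scale Basis
    using Basis finite_subset[OF _ F(1)] by unfold_locales auto
  define D where "D = L.derived_algebra"
  have D_sub: "L.subspace D" by (simp add: D_def L.derived_algebra_def)
  have D_dim: "L.dim D = 2" using assms(3) by (simp add: D_def)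
  have D_bracket: "bracket x y \<in> D" for x y
    unfolding D_def L.derived_algebra_def by (rule L.span_base) blast
  have D_central: "bracket d y = 0" if "d \<in> D" for d y
    using that assms(2) by (auto simp: D_def L.metabelian_def L.center_def)
  obtain \<xi> where \<xi>: "\<xi> \<in> L.dual_space" "L.dim (L.form_radical \<xi>) = L.index"
    using L.index_attained by blast
  have form: "alternating_form scale Basis (\<lambda>x y. \<zeta> (bracket x y))"
    if "Vector_Spaces.linear scale (*) \<zeta>" for \<zeta>
  proof -
    interpret \<zeta>: Vector_Spaces.linear scale "(*)" \<zeta> by (rule that)
    show ?thesis
      by unfold_locales (simp_all add: L.bracket_add_left L.bracket_add_right L.bracket_scale_left
          L.bracket_scale_right L.bracket_self \<zeta>.add \<zeta>.scale \<zeta>.zero)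
  qed
  have \<xi>_lin: "Vector_Spaces.linear scale (*) \<xi>" using \<xi>(1) by (simp add: L.dual_space_def)
  interpret A: alternating_form scale Basis "\<lambda>x y. \<xi> (bracket x y)" by (rule form[OF \<xi>_lin])
  interpret \<xi>: Vector_Spaces.linear scale "(*)" \<xi> by (rule \<xi>_lin)
  have A_radical: "A.radical = L.form_radical \<xi>"
    by (simp add: A.radical_def L.form_radical_def)
  have "D \<subseteq> A.radical" using D_central by (auto simp: A.radical_def \<xi>.zero)
  moreover have "L.dim A.radical \<le> L.dim D + 1"
    using assms(4) \<xi>(2) D_dim by (auto simp: A_radical)
  ultimately obtain v where v: "A.radical = L.span (insert v D)"
    using V.subspace_codim_le_1[OF D_sub A.subspace_radical] by blast

  \<comment> \<open>Otherwise the radical is all of \<open>L\<close>, so \<open>D\<close> has codimension at most one; since \<open>D\<close> is central,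
    \<open>L\<close> would be commutative.\<close>
  have "\<exists>d\<in>D. \<xi> d \<noteq> 0"
  proof (rule ccontr)
    assume "\<not> (\<exists>d\<in>D. \<xi> d \<noteq> 0)"
    then have "\<xi> (bracket x y) = 0" for x y using D_bracket by blast
    then have "A.radical = UNIV" unfolding A.radical_def by blast
    then have span: "L.span (insert v D) = UNIV" using v by simp
    have decomp: "\<exists>c d. d \<in> D \<and> x = scale c v + d" for x
    proof -
      have "x \<in> L.span (insert v D)" using span by simp
      then obtain c where "x - scale c v \<in> D"
        using D_sub by (metis L.span_breakdown_eq L.span_eq_iff)
      then show ?thesis by (metis add.commute diff_add_cancel)
    qed
    have skew: "bracket x d = 0" if "d \<in> D" for x d
    proof -
      have "bracket (x + d) (x + d) = 0" by (rule L.bracket_self)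
      then show ?thesis
        unfolding L.bracket_add_left L.bracket_add_right using D_central[OF that]
        by (simp add: L.bracket_self)
    qed
    have "bracket x y = 0" for x y
    proof -
      obtain c d c' d' where "d \<in> D" "x = scale c v + d" "d' \<in> D" "y = scale c' v + d'"
        using decomp by metis
      then show ?thesis
        by (simp add: L.bracket_add_left L.bracket_add_right L.bracket_scale_left
            L.bracket_scale_right L.bracket_self D_central skew)
    qed
    then have "D \<subseteq> {0}" unfolding D_def L.derived_algebra_def
      by (intro L.span_minimal) auto
    then have "L.dim D \<le> card {0::'l}"
      using L.dim_le_card[of D "{0}"] L.span_superset by (metis finite.simps order_trans)
    then show False using D_dim by simp
  qed
  then obtain \<eta> where \<eta>: "Vector_Spaces.linear scale (*) \<eta>"
    and sep: "\<And>x. x \<in> D \<Longrightarrow> \<xi> x = 0 \<Longrightarrow> \<eta> x = 0 \<Longrightarrow> x = 0"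
    using V.separating_functional_exists[OF D_sub D_dim \<xi>_lin] by blast
  interpret B: alternating_form scale Basis "\<lambda>x y. \<eta> (bracket x y)" by (rule form[OF \<eta>])
  interpret \<eta>: Vector_Spaces.linear scale "(*)" \<eta> by (rule \<eta>)
  interpret AB: alternating_pair_alg_closed scale Basis
    "\<lambda>x y. \<xi> (bracket x y)" "\<lambda>x y. \<eta> (bracket x y)" by unfold_locales
  have "D \<subseteq> B.radical" using D_central by (auto simp: B.radical_def \<eta>.zero)
  then obtain P where P: "A.perp P = P" "P \<subseteq> B.perp P"
    using AB.common_lagrangian[OF v] by blast
  have comm: "bracket x y = 0" if "x \<in> P" "y \<in> P" for x y
  proof (rule sep[OF D_bracket])
    show "\<xi> (bracket x y) = 0" using that P(1) by (auto simp: A.perp_def)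
    show "\<eta> (bracket x y) = 0" using that P(2) by (auto simp: B.perp_def)
  qed
  have P_sub: "L.subspace P" using A.subspace_perp[of P] P(1) by simp
  have "2 * L.dim P = L.dim (UNIV :: 'l set) + L.index"
    using A.dim_lagrangian[OF P(1)] \<xi>(2) by (simp add: A_radical)
  then have "2 * (of_nat (L.dim P) :: rat) = of_nat (L.dim (UNIV :: 'l set)) + of_nat L.index"
    by (metis of_nat_add of_nat_mult of_nat_numeral)
  then have "of_nat (L.dim P) = L.magic_number" by (simp add: L.magic_number_def)
  then have "L.commutative_polarization P"
    using P_sub comm by (simp add: L.commutative_polarization_def L.subalgebra_def
        L.commutative_def L.subspace_0)
  then show ?thesis by blast
qed

end
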